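(* Let $G$ be a finite simple graph with vertex set $[n]=\{1,\dots,n\}$. For any set of walks $\mathcal{W}$ on $G$ and any $\boldsymbol{p}=(p_1,\dots,p_n)\in[0,1)^n$, the following are equivalent: 1. $\boldsymbol{p}$ is valid for $\mathcal{W}$. 2. For every equivalence class $\widetilde{w}\in C(\mathcal{W})$ there exists $r_{\widetilde{w}}\in[0,1)$ such that, for every $\widetilde{w}\in C(\mathcal{W})$, $p_{\mathrm{t}(\widetilde{w})}\le r_{\widetilde{w}}\prod_{y\in\mathrm{Ext}(\widetilde{w})}(1-r_{\widetilde{y}})$.
   Context: A walk on $G$ is a nonempty finite string of vertices in which every two successive characters are adjacent in $G$. For a walk $w$, $\mathrm{t}(w)$ denotes its last vertex. For a set of walks $\mathcal{W}$ (finite or infinite) and $w\in\mathcal{W}$, $\mathrm{Ext}(w)$ is the set of walks in $\mathcal{W}$ that extend $w$ by one vertex at its end. Validity: $\boldsymbol{p}\in[0,1)^n$ is valid for $\mathcal{W}$ if there exists $L:\mathcal{W}\to[0,1)$ such that for all $w\in\mathcal{W}$, $p_{\mathrm{t}(w)}\le L(w)\prod_{y\in\mathrm{Ext}(w)}(1-L(y))$ (an empty product equals 1). Equivalence classes: for $w,w'\in\mathcal{W}$, write $w\sim w'$ if $\mathrm{t}(w)=\mathrm{t}(w')$ and $\{z: wz\in\mathcal{W}\}=\{z: w'z\in\mathcal{W}\}$, where $z$ ranges over strings over $[n]$ and $wz$ is concatenation. $\widetilde{w}$ denotes the equivalence class of $w$, and $C(\mathcal{W})$ the set of equivalence classes.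 If $w\sim w'$, then $wx\in\mathcal{W}$ iff $w'x\in\mathcal{W}$ for each vertex $x$, and in that case $wx\sim w'x$. So $\mathrm{t}(\widetilde{w}):=\mathrm{t}(w)$ and the product over $y\in\mathrm{Ext}(\widetilde{w})$ of terms depending only on the class $\widetilde{y}$, meaning the product over $y\in\mathrm{Ext}(w)$ for any representative $w$, are well defined. *)

theory Defs
  imports Complex_Main "Graph_Theory.Graph_Theory"
begin

text \<open>
  A finite simple graph is a \<^locale>\<open>pair_graph\<close>: a finite, loop-free, symmetric set of
  ordered pairs. A walk is a nonempty list of vertices satisfying \<^const>\<open>vwalk\<close>, and its last
  vertex is given by \<^const>\<open>last\<close>.
\<close>

definition ext :: "'a list set \<Rightarrow> 'a list \<Rightarrow> 'a list set" where
  "ext W w = {y \<in> W. \<exists>x. y = w @ [x]}"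

text \<open>Only the values of \<open>L\<close> on \<open>W\<close> matter, so \<open>L\<close> is a total function constrained on \<open>W\<close>.\<close>

definition valid :: "('a \<Rightarrow> real) \<Rightarrow> 'a list set \<Rightarrow> bool" where
  "valid p W \<longleftrightarrow>
     (\<exists>L :: 'a list \<Rightarrow> real.
        (\<forall>w\<in>W. L w \<in> {0..<1}) \<and>
        (\<forall>w\<in>W. p (last w) \<le> L w * (\<Prod>y\<in>ext W w. 1 - L y)))"

text \<open>
  The string \<open>z\<close> ranges over all lists. If \<open>W\<close> consists of walks on a graph, then \<open>w @ z \<in> W\<close>
  already forces every entry of \<open>z\<close> to be a vertex of that graph.
\<close>

definition walk_rel :: "'a list set \<Rightarrow> ('a list \<times> 'a list) set" where
  "walk_rel W =
     {(w, w'). w \<in> W \<and> w' \<in> W \<and> last w = last w' \<and> {z. w @ z \<in> W} = {z. w' @ z \<in> W}}"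

definition walk_class :: "'a list set \<Rightarrow> 'a list \<Rightarrow> 'a list set" where
  "walk_class W w = walk_rel W `` {w}"

definition walk_classes :: "'a list set \<Rightarrow> 'a list set set" where
  "walk_classes W = W // walk_rel W"

text \<open>
  Both functions below take the common value of all representatives of a class \<open>c\<close>. The lemmas
  \<open>class_end_walk_class\<close> and \<open>class_ext_prod_walk_class\<close> show that they are well defined.
\<close>

definition class_end :: "'a list set \<Rightarrow> 'a" where
  "class_end c = the_elem (last ` c)"

definition class_ext_prod :: "'a list set \<Rightarrow> ('a list set \<Rightarrow> real) \<Rightarrow> 'a list set \<Rightarrow> real" where
  "class_ext_prod W f c = the_elem ((\<lambda>w. \<Prod>y\<in>ext W w. f (walk_class W y)) ` c)"

lemma equiv_walk_rel: "equiv W (walk_rel W)"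
proof (rule equivI)
  show "walk_rel W \<subseteq> W \<times> W"
    unfolding walk_rel_def by blast
  show "refl_on W (walk_rel W)"
    unfolding walk_rel_def by (rule refl_onI) simp
  show "sym (walk_rel W)"
    unfolding walk_rel_def by (rule symI) simp
  show "trans (walk_rel W)"
    unfolding walk_rel_def by (rule transI) simp
qed

lemma walk_rel_append:
  assumes "(w, w') \<in> walk_rel W"
  shows "w @ z \<in> W \<longleftrightarrow> w' @ z \<in> W"
proof -
  have "{z. w @ z \<in> W} = {z. w' @ z \<in> W}"
    using assms unfolding walk_rel_def by simp
  from this[THEN eqset_imp_iff, of z] show ?thesis by simp
qed

lemma walk_rel_snoc:
  assumes "(w, w') \<in> walk_rel W" "w @ [x] \<in> W"
  shows "(w @ [x], w' @ [x]) \<in> walk_rel W"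
  using assms(2) walk_rel_append[OF assms(1)] by (simp add: walk_rel_def)

lemma ext_eq_image: "ext W w = (\<lambda>x. w @ [x]) ` {x. w @ [x] \<in> W}"
  by (auto simp: ext_def)

lemma ext_prod_cong:
  assumes "(w, w') \<in> walk_rel W"
  shows "(\<Prod>y\<in>ext W w. f (walk_class W y)) = (\<Prod>y\<in>ext W w'. f (walk_class W y))"
proof -
  have *: "(\<Prod>y\<in>ext W v. f (walk_class W y)) =
      (\<Prod>x\<in>{x. v @ [x] \<in> W}. f (walk_class W (v @ [x])))" for v
    unfolding ext_eq_image by (subst prod.reindex) (auto simp: inj_on_def)
  have "walk_class W (w @ [x]) = walk_class W (w' @ [x])" if "w @ [x] \<in> W" for x
    unfolding walk_class_def
    by (rule equiv_class_eq[OF equiv_walk_rel walk_rel_snoc[OF assms that]])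
  then show ?thesis
    unfolding * using walk_rel_append[OF assms] by (intro prod.cong) simp_all
qed

lemma the_elem_image_walk_class:
  assumes "w \<in> W" "\<And>w'. (w, w') \<in> walk_rel W \<Longrightarrow> g w' = g w"
  shows "the_elem (g ` walk_class W w) = g w"
proof -
  have "w \<in> walk_class W w"
    using assms(1) by (simp add: walk_class_def walk_rel_def)
  moreover have "g w' = g w" if "w' \<in> walk_class W w" for w'
    using that by (intro assms(2)) (simp add: walk_class_def)
  ultimately have "g ` walk_class W w = {g w}"
    by blast
  then show ?thesis by simp
qed

lemma class_end_walk_class:
  assumes "w \<in> W"
  shows "class_end (walk_class W w) = last w"
  unfolding class_end_def
  by (rule the_elem_image_walk_class[OF assms]) (simp add: walk_rel_def)

lemma class_ext_prod_walk_class: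
  assumes "w \<in> W"
  shows "class_ext_prod W f (walk_class W w) = (\<Prod>y\<in>ext W w. f (walk_class W y))"
  unfolding class_ext_prod_def
  by (rule the_elem_image_walk_class[OF assms]) (rule ext_prod_cong[symmetric])

text \<open>The products over \<^const>\<open>ext\<close> are finite, so \<^const>\<open>prod\<close> takes no default value in them.\<close>

lemma finite_ext:
  assumes "pair_graph G" "\<And>w. w \<in> W \<Longrightarrow> vwalk w (with_proj G)"
  shows "finite (ext W w)"
proof -
  interpret pair_graph G by fact
  have "ext W w \<subseteq> (\<lambda>x. w @ [x]) ` pverts G"
  proof
    fix y assume "y \<in> ext W w"
    then obtain x where x: "y \<in> W" "y = w @ [x]"
      unfolding ext_def by blast
    have "set y \<subseteq> pverts G"
      using assms(2)[OF x(1)] unfolding vwalk_def by simp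
    then show "y \<in> (\<lambda>x. w @ [x]) ` pverts G"
      using x(2) by simp
  qed
  then show ?thesis
    using pair_finite_verts finite_subset by blast
qed

end

theory Submission
  imports Defs
begin

text \<open>
  Given \<open>L\<close> on walks, let \<open>r\<close> be its infimum over each class. The inequality for a walk \<open>w\<close>
  survives replacing each \<open>L y\<close> by \<open>r\<close> of the class of \<open>y\<close>, which only increases the product;
  the new product is positive and the same for every representative \<open>w\<close>, so the factor \<open>L w\<close>
  can be replaced by its infimum. Conversely, composing \<open>r\<close> with the class map gives \<open>L\<close>.
\<close>

lemma ball_walk_classes: "(\<forall>c\<in>walk_classes W. P c) \<longleftrightarrow> (\<forall>w\<in>W. P (walk_class W w))"
  by (auto simp: walk_classes_def walk_class_def quotient_def)

lemma walk_class_self: "w \<in> W \<Longrightarrow> w \<in> walk_class W w"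
  by (simp add: walk_class_def walk_rel_def)

lemma walk_class_subset: "walk_class W w \<subseteq> W"
  by (auto simp: walk_class_def walk_rel_def)

text \<open>Together with \<open>ball_walk_classes\<close>, this turns the condition on classes into
  one on walks, so both directions of the equivalence can be argued on walks alone.\<close>

lemma class_bound_iff:
  assumes "w \<in> W"
  shows "p (class_end (walk_class W w)) \<le>
      r (walk_class W w) * class_ext_prod W (\<lambda>d. 1 - r d) (walk_class W w) \<longleftrightarrow>
    p (last w) \<le> r (walk_class W w) * (\<Prod>y\<in>ext W w. 1 - r (walk_class W y))"
  by (simp add: class_end_walk_class[OF assms] class_ext_prod_walk_class[OF assms])

text \<open>A class may be infinite and its infimum not attained, so no minimising walk is picked:
  the argument rests on \<open>r_le\<close> and \<open>le_r\<close>, the two halves of being a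
  greatest lower bound.\<close>

lemma Inf_class_bound:
  fixes L :: "'a list \<Rightarrow> real"
  defines "r \<equiv> \<lambda>c. INF w\<in>c. L w"
  assumes L: "\<And>w. w \<in> W \<Longrightarrow> L w \<in> {0..<1}"
    and bound: "\<And>w. w \<in> W \<Longrightarrow> p (last w) \<le> L w * (\<Prod>y\<in>ext W w. 1 - L y)"
    and w: "w \<in> W"
  shows "r (walk_class W w) \<in> {0..<1}"
    and "p (last w) \<le> r (walk_class W w) * (\<Prod>y\<in>ext W w. 1 - r (walk_class W y))"
proof -
  have r_le: "r (walk_class W v) \<le> L v" if "v \<in> W" for v
    unfolding r_def
  proof (rule cINF_lower)
    show "bdd_below (L ` walk_class W v)"
      using L walk_class_subset by (intro bdd_belowI2[of _ 0]) force
  qed (rule walk_class_self[OF that])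
  have le_r: "a \<le> r (walk_class W v)"
    if "v \<in> W" "\<And>u. u \<in> walk_class W v \<Longrightarrow> a \<le> L u" for a v
    unfolding r_def using walk_class_self[OF that(1)] that(2) by (intro cINF_greatest) auto
  have r01: "r (walk_class W v) \<in> {0..<1}" if "v \<in> W" for v
  proof -
    have "0 \<le> r (walk_class W v)"
      using L walk_class_subset by (intro le_r[OF that]) force
    \<comment> \<open>Strictness at 1 comes from the single value \<open>L v\<close> above the
      infimum.\<close>
    then show ?thesis
      using r_le[OF that] L[OF that] by simp
  qed
  show "r (walk_class W w) \<in> {0..<1}"
    by (rule r01[OF w])
  define P where "P = (\<Prod>y\<in>ext W w. 1 - r (walk_class W y))"
  \<comment> \<open>Each factor is positive because \<open>r\<close> stays strictly below 1. For an
    infinite \<open>ext W w\<close> the product would take its default value 1, also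
    positive.\<close>
  have "P > 0"
    unfolding P_def using r01 by (intro prod_pos) (simp add: ext_def)
  \<comment> \<open>Division by \<open>P\<close> leaves a constant that bounds \<open>L\<close> from
    below on the whole class, and the infimum inherits this bound.\<close>
  have "p (last w) / P \<le> r (walk_class W w)"
  proof (rule le_r[OF w])
    fix u assume "u \<in> walk_class W w"
    then have rel: "(w, u) \<in> walk_rel W" and u: "u \<in> W" and last: "last w = last u"
      by (auto simp: walk_class_def walk_rel_def)
    have "(\<Prod>y\<in>ext W u. 1 - L y) \<le> (\<Prod>y\<in>ext W u. 1 - r (walk_class W y))"
      using L r_le by (intro prod_mono) (force simp: ext_def)
    \<comment> \<open>Related walks extend by the same vertices, and to related walks.\<close>
    also have "\<dots> = P"
      unfolding P_def by (rule ext_prod_cong[OF rel, symmetric])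
    finally have "L u * (\<Prod>y\<in>ext W u. 1 - L y) \<le> L u * P"
      using L[OF u] by (intro mult_left_mono) simp_all
    then have "p (last w) \<le> L u * P"
      using bound[OF u] last by simp
    then show "p (last w) / P \<le> L u"
      using \<open>P > 0\<close> by (simp add: pos_divide_le_eq)
  qed
  then show "p (last w) \<le> r (walk_class W w) * (\<Prod>y\<in>ext W w. 1 - r (walk_class W y))"
    using \<open>P > 0\<close> by (simp add: pos_divide_le_eq P_def)
qed

theorem theorem2:
  fixes n :: nat
    and G :: "nat pair_pre_digraph"
    and W :: "nat list set"
    and p :: "nat \<Rightarrow> real"
  assumes "pair_graph G"
    and "pverts G = {1..n}"
    and "\<And>w. w \<in> W \<Longrightarrow> vwalk w (with_proj G)"
    and "\<And>i. i \<in> {1..n} \<Longrightarrow> p i \<in> {0..<1}"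
  shows "valid p W \<longleftrightarrow>
    (\<exists>r :: nat list set \<Rightarrow> real.
       (\<forall>c\<in>walk_classes W. r c \<in> {0..<1}) \<and>
       (\<forall>c\<in>walk_classes W. p (class_end c) \<le> r c * class_ext_prod W (\<lambda>d. 1 - r d) c))"
proof
  assume "valid p W"
  then obtain L :: "nat list \<Rightarrow> real" where L: "\<And>w. w \<in> W \<Longrightarrow> L w \<in> {0..<1}"
      "\<And>w. w \<in> W \<Longrightarrow> p (last w) \<le> L w * (\<Prod>y\<in>ext W w. 1 - L y)"
    unfolding valid_def by blast
  define r where "r = (\<lambda>c. INF w\<in>c. L w)"
  have "r (walk_class W w) \<in> {0..<1}"
      "p (last w) \<le> r (walk_class W w) * (\<Prod>y\<in>ext W w. 1 - r (walk_class W y))" if "w \<in> W" for w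
    unfolding r_def using Inf_class_bound[where p = p, OF L that] by blast+
  then show "\<exists>r :: nat list set \<Rightarrow> real.
       (\<forall>c\<in>walk_classes W. r c \<in> {0..<1}) \<and>
       (\<forall>c\<in>walk_classes W. p (class_end c) \<le> r c * class_ext_prod W (\<lambda>d. 1 - r d) c)"
    unfolding ball_walk_classes using class_bound_iff by blast
next
  assume "\<exists>r :: nat list set \<Rightarrow> real.
       (\<forall>c\<in>walk_classes W. r c \<in> {0..<1}) \<and>
       (\<forall>c\<in>walk_classes W. p (class_end c) \<le> r c * class_ext_prod W (\<lambda>d. 1 - r d) c)"
  \<comment> \<open>Read on walks, the conditions on \<open>r\<close> are literally those of
    \<open>valid\<close> for the composition of \<open>r\<close> with the class map.\<close>
  then obtain r :: "nat list set \<Rightarrow> real" where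
      "\<forall>w\<in>W. r (walk_class W w) \<in> {0..<1}"
      "\<forall>w\<in>W. p (last w) \<le> r (walk_class W w) * (\<Prod>y\<in>ext W w. 1 - r (walk_class W y))"
    unfolding ball_walk_classes using class_bound_iff by blast
  then show "valid p W"
    unfolding valid_def by (intro exI[of _ "\<lambda>w. r (walk_class W w)"] conjI)
qed

end
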